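(* Let $\alpha \in (0,1)$ and let $\mathcal{C}_L$ be a metric cycle graph of total length $L$ with at least one Dirichlet vertex $v_0$. Cutting $\mathcal{C}_L$ at $v_0$ yields an interval graph $\mathcal{I}_L$ of the same length with Dirichlet boundary conditions at both endpoints. Then $$T_{\alpha}(\mathcal{C}_L) =T_{\alpha}(\mathcal{I}_L).$$
   Context: A compact metric graph $\mathcal{G}$ is obtained from a finite graph with vertex set $\mathcal{V}$ and edge set $\mathcal{E}$ (loops and parallel edges allowed) by identifying each edge $e$ with an interval $[0,\ell_e]$, $0<\ell_e<\infty$, and gluing endpoints according to the graph structure. Its total length is $\sum_{e}\ell_e$. A nonempty set $\mathcal{V}_D\subseteq\mathcal{V}$ of Dirichlet vertices is fixed. $L^2(\mathcal{G})=\bigoplus_{e}L^2(0,\ell_e)$ with inner product $\langle\cdot,\cdot\rangle$. The Laplacian $-\Delta_{\mathcal{G}}$ acts as $-f_e''$ on each edge, with domain the edgewise $H^2$ functions that vanish at every $v\in\mathcal{V}_D$ and at every $v\in\mathcal{V}\setminus\mathcal{V}_D$ are continuous and satisfy the Kirchhoff condition: the sum, over all edge ends incident to $v$, of the derivatives at $v$ taken in the direction pointing into $v$, is zero. It is self-adjoint with compact resolvent, with eigenvalues $0<\lambda_1\le\lambda_2\le\cdots\to\infty$ (with multiplicity) and an $L^2$-orthonormal basis of eigenfunctions $\varphi_n$. For $\alpha\in(0,1)$, $(-\Delta_{\mathcal{G}})^\alpha f=\sum_n\lambda_n^\alpha\langle f,\varphi_n\rangle\varphi_n$ on the domain $\{f\in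 L^2(\mathcal{G}):\sum_n\lambda_n^{2\alpha}|\langle f,\varphi_n\rangle|^2<\infty\}$. The fractional torsion function $u_\alpha$ is the unique solution of $(-\Delta_{\mathcal{G}})^\alpha u_\alpha=1$, i.e. $u_\alpha=\sum_n\lambda_n^{-\alpha}\langle 1,\varphi_n\rangle\varphi_n$, and the fractional torsional rigidity is $T_\alpha(\mathcal{G})=\int_{\mathcal{G}}u_\alpha\,dx=\sum_n\lambda_n^{-\alpha}|\langle1,\varphi_n\rangle|^2$. A cycle graph is a metric graph whose underlying topological space is a single closed loop, with finitely many vertices on it. Cutting it at the vertex $v_0$ means splitting $v_0$ into two boundary points $v_0^-$ and $v_0^+$, so that the loop unfolds to an interval with endpoints $v_0^\pm$; the other vertices of the cycle lie along the resulting path. *)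

theory Defs
  imports "HOL-Analysis.Analysis" "Graph_Theory.Digraph"
begin

section \<open>Compact metric graphs\<close>

text \<open>
  The orientation of the arcs only serves to identify an edge \<open>e\<close> with \<open>[0, len e]\<close>: the tail sits
  at \<open>0\<close> and the head at \<open>len e\<close>.
\<close>

record ('v, 'e) metric_graph =
  graph :: "('v, 'e) pre_digraph"
  len :: "'e \<Rightarrow> real"
  dirichlet_verts :: "'v set"

abbreviation vertices :: "('v, 'e) metric_graph \<Rightarrow> 'v set" where
  "vertices G \<equiv> verts (graph G)"

abbreviation edges :: "('v, 'e) metric_graph \<Rightarrow> 'e set" where
  "edges G \<equiv> arcs (graph G)"

definition compact_metric_graph :: "('v, 'e) metric_graph \<Rightarrow> bool" where
  "compact_metric_graph G \<longleftrightarrow>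
     fin_digraph (graph G) \<and> (\<forall>e\<in>edges G. 0 < len G e) \<and>
     dirichlet_verts G \<noteq> {} \<and> dirichlet_verts G \<subseteq> vertices G"

definition total_length :: "('v, 'e) metric_graph \<Rightarrow> real" where
  "total_length G = (\<Sum>e\<in>edges G. len G e)"

datatype 'e edge_end = Tail_End 'e | Head_End 'e

fun end_edge :: "'e edge_end \<Rightarrow> 'e" where
  "end_edge (Tail_End e) = e"
| "end_edge (Head_End e) = e"

fun end_vertex :: "('v, 'e) metric_graph \<Rightarrow> 'e edge_end \<Rightarrow> 'v" where
  "end_vertex G (Tail_End e) = tail (graph G) e"
| "end_vertex G (Head_End e) = head (graph G) e"

text \<open>A loop at \<open>v\<close> contributes two edge ends at \<open>v\<close>.\<close>

definition ends_at :: "('v, 'e) metric_graph \<Rightarrow> 'v \<Rightarrow> 'e edge_end set" where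
  "ends_at G v = {k. end_edge k \<in> edges G \<and> end_vertex G k = v}"

subsection \<open>The underlying topological space\<close>

datatype ('v, 'e) point = Vertex 'v | Inner 'e real

definition chart :: "('v, 'e) metric_graph \<Rightarrow> 'e \<Rightarrow> real \<Rightarrow> ('v, 'e) point" where
  "chart G e x =
     (if x = 0 then Vertex (tail (graph G) e)
      else if x = len G e then Vertex (head (graph G) e)
      else Inner e x)"

definition points :: "('v, 'e) metric_graph \<Rightarrow> ('v, 'e) point set" where
  "points G = Vertex ` vertices G \<union> (\<Union>e\<in>edges G. chart G e ` {0..len G e})"

text \<open>
  The quotient topology of the disjoint union of the intervals \<open>[0, len e]\<close> (and of the vertices,
  so that isolated vertices are covered) under the gluing of end points.
\<close>

definition graph_topology :: "('v, 'e) metric_graph \<Rightarrow> ('v, 'e) point topology" where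
  "graph_topology G = topology (\<lambda>U. U \<subseteq> points G \<and>
     (\<forall>e\<in>edges G. openin (top_of_set {0..len G e}) {x \<in> {0..len G e}. chart G e x \<in> U}))"

definition cycle_graph :: "('v, 'e) metric_graph \<Rightarrow> bool" where
  "cycle_graph G \<longleftrightarrow>
     compact_metric_graph G \<and>
     graph_topology G homeomorphic_space top_of_set (sphere (0::complex) 1)"

definition interval_graph :: "('v, 'e) metric_graph \<Rightarrow> 'v \<Rightarrow> 'v \<Rightarrow> bool" where
  "interval_graph G a b \<longleftrightarrow>
     compact_metric_graph G \<and> a \<in> vertices G \<and> b \<in> vertices G \<and>
     (\<exists>h. homeomorphic_map (graph_topology G) (top_of_set {0..total_length G}) h \<and>
          h (Vertex a) = 0 \<and> h (Vertex b) = total_length G)"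

subsection \<open>Cutting at a vertex\<close>

datatype 'v cut_vertex = Old 'v | Cut_Minus | Cut_Plus

definition cut_end :: "('v, 'e) metric_graph \<Rightarrow> 'v \<Rightarrow> 'e edge_end \<Rightarrow> 'e edge_end \<Rightarrow> 'v cut_vertex" where
  "cut_end G v h k =
     (if end_vertex G k \<noteq> v then Old (end_vertex G k)
      else if k = h then Cut_Minus else Cut_Plus)"

text \<open>
  Splits \<open>v\<close> into two Dirichlet vertices. The edge end \<open>h\<close> at \<open>v\<close> is attached to \<open>Cut_Minus\<close> and
  every other edge end at \<open>v\<close> to \<open>Cut_Plus\<close>; on a cycle there is exactly one other end.
\<close>

definition cut_at :: "('v, 'e) metric_graph \<Rightarrow> 'v \<Rightarrow> 'e edge_end \<Rightarrow> ('v cut_vertex, 'e) metric_graph" where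
  "cut_at G v h =
     \<lparr> graph =
         \<lparr> verts = Old ` (vertices G - {v}) \<union> {Cut_Minus, Cut_Plus},
           arcs = edges G,
           tail = (\<lambda>e. cut_end G v h (Tail_End e)),
           head = (\<lambda>e. cut_end G v h (Head_End e)) \<rparr>,
       len = len G,
       dirichlet_verts = Old ` (dirichlet_verts G - {v}) \<union> {Cut_Minus, Cut_Plus} \<rparr>"

section \<open>The space $L^2$ of a metric graph\<close>

text \<open>
  Functions on the graph are given edgewise. Elements of \<open>L2 G\<close> are representatives; two of them
  denote the same element of $L^2$ iff they agree almost everywhere on every edge.
\<close>

definition sq_integrable :: "real \<Rightarrow> (real \<Rightarrow> real) \<Rightarrow> bool" where
  "sq_integrable l f \<longleftrightarrow>
     f \<in> borel_measurable (lebesgue_on {0..l}) \<and> integrable (lebesgue_on {0..l}) (\<lambda>x. (f x)\<^sup>2)"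

definition L2 :: "('v, 'e) metric_graph \<Rightarrow> ('e \<Rightarrow> real \<Rightarrow> real) set" where
  "L2 G = {f. \<forall>e\<in>edges G. sq_integrable (len G e) (f e)}"

definition graph_integral :: "('v, 'e) metric_graph \<Rightarrow> ('e \<Rightarrow> real \<Rightarrow> real) \<Rightarrow> real" where
  "graph_integral G f = (\<Sum>e\<in>edges G. LINT x|lebesgue_on {0..len G e}. f e x)"

definition L2_inner :: "('v, 'e) metric_graph \<Rightarrow> ('e \<Rightarrow> real \<Rightarrow> real) \<Rightarrow> ('e \<Rightarrow> real \<Rightarrow> real) \<Rightarrow> real" where
  "L2_inner G f g = graph_integral G (\<lambda>e x. f e x * g e x)"

definition L2_norm :: "('v, 'e) metric_graph \<Rightarrow> ('e \<Rightarrow> real \<Rightarrow> real) \<Rightarrow> real" where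
  "L2_norm G f = sqrt (L2_inner G f f)"

definition L2_sums ::
    "('v, 'e) metric_graph \<Rightarrow> (nat \<Rightarrow> 'e \<Rightarrow> real \<Rightarrow> real) \<Rightarrow> ('e \<Rightarrow> real \<Rightarrow> real) \<Rightarrow> bool" where
  "L2_sums G F f \<longleftrightarrow>
     f \<in> L2 G \<and> (\<forall>n. F n \<in> L2 G) \<and>
     (\<lambda>N. L2_norm G (\<lambda>e x. f e x - (\<Sum>n<N. F n e x))) \<longlonglongrightarrow> 0"

section \<open>The Laplacian\<close>

text \<open>
  \<open>f\<close> is the continuously differentiable representative of an element of $H^2(0,l)$: its derivative
  \<open>f1\<close> is absolutely continuous on \<open>[0, l]\<close>, with square integrable derivative \<open>f2\<close>.
\<close>

definition H2_derivs :: "real \<Rightarrow> (real \<Rightarrow> real) \<Rightarrow> (real \<Rightarrow> real) \<Rightarrow> (real \<Rightarrow> real) \<Rightarrow> bool" where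
  "H2_derivs l f f1 f2 \<longleftrightarrow>
     sq_integrable l f2 \<and>
     (\<forall>x\<in>{0..l}. (f has_real_derivative f1 x) (at x within {0..l}) \<and>
                 f1 x = f1 0 + (LINT y|lebesgue_on {0..x}. f2 y))"

fun end_value :: "('v, 'e) metric_graph \<Rightarrow> ('e \<Rightarrow> real \<Rightarrow> real) \<Rightarrow> 'e edge_end \<Rightarrow> real" where
  "end_value G f (Tail_End e) = f e 0"
| "end_value G f (Head_End e) = f e (len G e)"

text \<open>
  The derivative pointing into the vertex, computed from the edgewise derivative \<open>f1\<close> in the
  direction from tail to head.
\<close>

fun inward_deriv :: "('v, 'e) metric_graph \<Rightarrow> ('e \<Rightarrow> real \<Rightarrow> real) \<Rightarrow> 'e edge_end \<Rightarrow> real" where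
  "inward_deriv G f1 (Tail_End e) = - f1 e 0"
| "inward_deriv G f1 (Head_End e) = f1 e (len G e)"

text \<open>
  The graph of the operator: \<open>f\<close> lies in the domain and \<open>g\<close> represents its image. Note that \<open>f\<close> is
  the continuous representative, whereas \<open>g\<close> may be changed on null sets.
\<close>

definition neg_laplacian :: "('v, 'e) metric_graph \<Rightarrow> ('e \<Rightarrow> real \<Rightarrow> real) \<Rightarrow> ('e \<Rightarrow> real \<Rightarrow> real) \<Rightarrow> bool" where
  "neg_laplacian G f g \<longleftrightarrow>
     (\<exists>f1. (\<forall>e\<in>edges G. H2_derivs (len G e) (f e) (f1 e) (\<lambda>x. - g e x)) \<and>
           (\<forall>v\<in>dirichlet_verts G. \<forall>k\<in>ends_at G v. end_value G f k = 0) \<and>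
           (\<forall>v\<in>vertices G - dirichlet_verts G.
              (\<forall>k\<in>ends_at G v. \<forall>k'\<in>ends_at G v. end_value G f k = end_value G f k') \<and>
              (\<Sum>k\<in>ends_at G v. inward_deriv G f1 k) = 0))"

definition eigenbasis ::
    "('v, 'e) metric_graph \<Rightarrow> (nat \<Rightarrow> real) \<Rightarrow> (nat \<Rightarrow> 'e \<Rightarrow> real \<Rightarrow> real) \<Rightarrow> bool" where
  "eigenbasis G \<mu> \<phi> \<longleftrightarrow>
     0 < \<mu> 0 \<and> incseq \<mu> \<and> filterlim \<mu> at_top sequentially \<and>
     (\<forall>n. neg_laplacian G (\<phi> n) (\<lambda>e x. \<mu> n * \<phi> n e x)) \<and>
     (\<forall>m n. L2_inner G (\<phi> m) (\<phi> n) = (if m = n then 1 else 0)) \<and>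
     (\<forall>f\<in>L2 G. L2_sums G (\<lambda>n e x. L2_inner G f (\<phi> n) * \<phi> n e x) f)"

section \<open>The fractional Laplacian and torsional rigidity\<close>

text \<open>
  Again the graph of the operator, on representatives. It does not depend on the eigenbasis, since
  any two of them differ by an orthogonal transformation of each (finite-dimensional) eigenspace.
\<close>

definition frac_laplacian ::
    "real \<Rightarrow> ('v, 'e) metric_graph \<Rightarrow> ('e \<Rightarrow> real \<Rightarrow> real) \<Rightarrow> ('e \<Rightarrow> real \<Rightarrow> real) \<Rightarrow> bool" where
  "frac_laplacian \<alpha> G f g \<longleftrightarrow>
     f \<in> L2 G \<and>
     (\<exists>\<mu> \<phi>. eigenbasis G \<mu> \<phi> \<and>
        summable (\<lambda>n. \<mu> n powr (2 * \<alpha>) * \<bar>L2_inner G f (\<phi> n)\<bar>\<^sup>2) \<and>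
        L2_sums G (\<lambda>n e x. \<mu> n powr \<alpha> * L2_inner G f (\<phi> n) * \<phi> n e x) g)"

text \<open>The solution is unique up to null sets; \<open>SOME\<close> picks a representative.\<close>

definition frac_torsion :: "real \<Rightarrow> ('v, 'e) metric_graph \<Rightarrow> 'e \<Rightarrow> real \<Rightarrow> real" where
  "frac_torsion \<alpha> G = (SOME u. frac_laplacian \<alpha> G u (\<lambda>e x. 1))"

definition torsional_rigidity :: "real \<Rightarrow> ('v, 'e) metric_graph \<Rightarrow> real" where
  "torsional_rigidity \<alpha> G = graph_integral G (frac_torsion \<alpha> G)"

end

theory Submission
  imports Defs
begin

text \<open>
  A Dirichlet condition does not couple the edge ends at its vertex, so the Laplacians of the cycle
  and of the cut graph, viewed edgewise, have literally the same graph; hence so do their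
  fractional powers, and the torsional rigidities agree.

  For the cut graph to be an interval, take a homeomorphism of the cycle onto the unit circle that
  sends the cut vertex to 1. Near the vertex each edge end is mapped into the open upper or the
  open lower half plane. Two ends in the same half plane would meet by the intermediate value
  theorem, so the angle in \<open>(0, 2\<pi>)\<close> extends continuously to the two new vertices. It
  is then a continuous bijection from a compact space onto \<open>[0, 2\<pi>]\<close>.
\<close>

section \<open>The quotient topology of a metric graph: open sets, continuous maps and
  compactness\<close>

lemma chart_in_points: "e \<in> edges G \<Longrightarrow> x \<in> {0..len G e} \<Longrightarrow> chart G e x \<in> points G"
  unfolding points_def by blast

text \<open>Preimages under charts commute with intersections and unions, so the defining family is
  a topology and \<open>topology\<close> can be inverted on it.\<close>

lemma openin_graph_topology:
  "openin (graph_topology G) U \<longleftrightarrow> U \<subseteq> points G \<and>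
     (\<forall>e\<in>edges G. openin (top_of_set {0..len G e}) {x \<in> {0..len G e}. chart G e x \<in> U})"
proof -
  let ?P = "\<lambda>e U. {x \<in> {0..len G e}. chart G e x \<in> U}"
  have "istopology (\<lambda>U. U \<subseteq> points G \<and>
     (\<forall>e\<in>edges G. openin (top_of_set {0..len G e}) (?P e U)))"
    unfolding istopology_def
  proof (rule conjI; intro allI impI)
    fix S T
    assume "S \<subseteq> points G \<and> (\<forall>e\<in>edges G. openin (top_of_set {0..len G e}) (?P e S))"
      "T \<subseteq> points G \<and> (\<forall>e\<in>edges G. openin (top_of_set {0..len G e}) (?P e T))"
    moreover have "?P e (S \<inter> T) = ?P e S \<inter> ?P e T" for e
      by blast
    ultimately show "S \<inter> T \<subseteq> points G \<and>
        (\<forall>e\<in>edges G. openin (top_of_set {0..len G e}) (?P e (S \<inter> T)))"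
      by (auto intro!: openin_Int)
  next
    fix K
    assume "\<forall>U\<in>K. U \<subseteq> points G \<and>
      (\<forall>e\<in>edges G. openin (top_of_set {0..len G e}) (?P e U))"
    moreover have "?P e (\<Union>K) = \<Union>(?P e ` K)" for e
      by blast
    ultimately show "\<Union>K \<subseteq> points G \<and>
        (\<forall>e\<in>edges G. openin (top_of_set {0..len G e}) (?P e (\<Union>K)))"
      by (auto simp del: UN_simps intro!: openin_Union)
  qed
  then show ?thesis
    by (simp add: graph_topology_def topology_inverse')
qed

lemma topspace_graph_topology [simp]: "topspace (graph_topology G) = points G"
proof -
  have "openin (graph_topology G) (points G)"
    unfolding openin_graph_topology
  proof (intro conjI ballI subset_refl)
    fix e assume "e \<in> edges G"
    then have "{x \<in> {0..len G e}. chart G e x \<in> points G} = {0..len G e}"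
      using chart_in_points[of e G] by auto
    then show "openin (top_of_set {0..len G e}) {x \<in> {0..len G e}. chart G e x \<in> points G}"
      by simp
  qed
  then show ?thesis
    by (metis openin_graph_topology openin_subset openin_topspace subset_antisym)
qed

lemma continuous_map_chart:
  assumes "e \<in> edges G"
  shows "continuous_map (top_of_set {0..len G e}) (graph_topology G) (chart G e)"
  using assms chart_in_points[OF assms]
  by (simp add: continuous_map_def openin_graph_topology Pi_iff)

text \<open>The universal property of the quotient: openness of a preimage is tested edge by edge,
  through the charts.\<close>

lemma continuous_map_from_graph:
  assumes "F ` points G \<subseteq> topspace T"
    and "\<And>e. e \<in> edges G \<Longrightarrow> continuous_map (top_of_set {0..len G e}) T (\<lambda>x. F (chart G e x))"
  shows "continuous_map (graph_topology G) T F"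
  unfolding continuous_map_def
proof (intro conjI allI impI)
  show "F \<in> topspace (graph_topology G) \<rightarrow> topspace T"
    using assms(1) by auto
  fix U assume U: "openin T U"
  have "openin (top_of_set {0..len G e}) {x \<in> {0..len G e}. chart G e x \<in> {p \<in> points G. F p \<in> U}}"
    if "e \<in> edges G" for e
  proof -
    have "{x \<in> {0..len G e}. chart G e x \<in> {p \<in> points G. F p \<in> U}}
        = {x \<in> topspace (top_of_set {0..len G e}). F (chart G e x) \<in> U}"
      using chart_in_points[OF that] by auto
    then show ?thesis
      using openin_continuous_map_preimage[OF assms(2)[OF that] U] by simp
  qed
  then show "openin (graph_topology G) {p \<in> topspace (graph_topology G). F p \<in> U}"
    by (auto simp: openin_graph_topology)
qed

text \<open>Finitely many vertices and finitely many chart images of compact intervals cover the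
  graph.\<close>

lemma compact_space_graph_topology:
  assumes "compact_metric_graph G"
  shows "compact_space (graph_topology G)"
proof -
  have fin: "finite (vertices G)" "finite (edges G)"
    using assms by (auto simp: compact_metric_graph_def fin_digraph_def fin_digraph_axioms_def)
  have "compactin (graph_topology G) (Vertex ` vertices G)"
    using fin by (intro finite_imp_compactin) (auto simp: points_def)
  moreover have "compactin (graph_topology G) (\<Union>e\<in>edges G. chart G e ` {0..len G e})"
  proof (intro compactin_Union, goal_cases)
    case (2 S)
    then obtain e where e: "e \<in> edges G" "S = chart G e ` {0..len G e}"
      by blast
    have "compactin (top_of_set {0..len G e}) {0..len G e}"
      by (simp add: compactin_subtopology)
    then show ?case
      unfolding e(2) by (rule image_compactin[OF _ continuous_map_chart[OF e(1)]])
  qed (use fin in auto)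
  ultimately show ?thesis
    by (simp add: compact_space_def points_def compactin_Un)
qed

text \<open>Charts produce \<open>Inner\<close> points only strictly inside an edge, and
  well-formedness makes all end points vertices. This normal form lets the points of a graph and of
  its cut be compared by cases.\<close>

lemma points_eq:
  assumes "compact_metric_graph G"
  shows "points G = Vertex ` vertices G \<union> {Inner e x | e x. e \<in> edges G \<and> 0 < x \<and> x < len G e}"
proof -
  have "tail (graph G) e \<in> vertices G" "head (graph G) e \<in> vertices G" if "e \<in> edges G" for e
    using assms that by (auto simp: compact_metric_graph_def fin_digraph_def wf_digraph_def)
  then have "points G \<subseteq> Vertex ` vertices G \<union> {Inner e x | e x. e \<in> edges G \<and> 0 < x \<and> x < len G e}"
    by (auto simp: points_def chart_def)
  moreover have "Inner e x \<in> points G" if "e \<in> edges G" "0 < x" "x < len G e" for e x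
  proof -
    have "Inner e x = chart G e x"
      using that by (simp add: chart_def)
    then show ?thesis
      using that chart_in_points[of e G x] by simp
  qed
  moreover have "Vertex ` vertices G \<subseteq> points G"
    by (simp add: points_def)
  ultimately show ?thesis
    by blast
qed

subsection \<open>Arcs of the unit circle issuing from 1\<close>

text \<open>\<open>Arg2pi\<close> jumps across the positive real axis, where the arcs below start,
  while \<open>Arg\<close> is continuous there. Expressing one by the other in each half plane
  yields the one-sided limits at 1.\<close>

lemma Arg2pi_eq_Arg:
  assumes "Im z \<noteq> 0"
  shows "Arg2pi z = (if 0 < Im z then Arg z else 2 * pi + Arg z)"
proof -
  have z: "z \<noteq> 0"
    using assms by auto
  have arg: "is_Arg z (Arg z)"
    using z by (rule is_Arg_Arg)
  moreover have "is_Arg z (2 * pi + Arg z)"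
    using arg is_Arg_2pi_iff[of z "Arg z" 1] by (simp add: add.commute)
  moreover have "0 \<le> Arg z \<longleftrightarrow> 0 < Im z" "- pi < Arg z" "Arg z \<le> pi" "0 < pi"
    using assms Arg_less_0[of z] mpi_less_Arg[of z] Arg_le_pi[of z] pi_gt_zero by auto
  ultimately show ?thesis
    using Arg2pi[of z] z by (auto intro!: Arg2pi_unique_lemma[of z])
qed

text \<open>On the right half of the circle the imaginary part is a coordinate: it determines the
  square of the real part, and positivity picks the root.\<close>

lemma circle_eqI:
  fixes z w :: complex
  assumes "cmod z = 1" "cmod w = 1" "Im z = Im w" "0 < Re z" "0 < Re w"
  shows "z = w"
proof -
  have "(Re z)\<^sup>2 = (Re w)\<^sup>2"
    using assms(1-3) cmod_power2[of z] cmod_power2[of w] by simp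
  then have "Re z = Re w"
    using assms by (simp add: power2_eq_iff_nonneg)
  then show ?thesis
    using assms by (simp add: complex_eq_iff)
qed

text \<open>By continuity a short initial piece stays in the right half plane. There the circle
  meets the real axis only at 1, which injectivity reserves for time 0, so the imaginary part keeps
  its sign.\<close>

lemma circle_arc_one_side:
  fixes \<gamma> :: "real \<Rightarrow> complex"
  assumes "0 < d" and cont: "continuous_on {0..d} \<gamma>" and inj: "inj_on \<gamma> {0..d}"
    and circ: "\<And>t. t \<in> {0..d} \<Longrightarrow> cmod (\<gamma> t) = 1" and "\<gamma> 0 = 1"
  obtains s \<epsilon> where "s = 1 \<or> s = -1" "0 < \<epsilon>" "\<epsilon> \<le> d"
    "\<And>t. 0 < t \<Longrightarrow> t \<le> \<epsilon> \<Longrightarrow> 0 < Re (\<gamma> t) \<and> 0 < s * Im (\<gamma> t)"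
proof -
  have "continuous_on {0..d} (\<lambda>t. Re (\<gamma> t))"
    by (intro continuous_intros cont)
  then obtain r where "0 < r" "\<And>t. t \<in> {0..d} \<Longrightarrow> dist t 0 < r \<Longrightarrow> dist (Re (\<gamma> t)) (Re (\<gamma> 0)) < 1"
    using \<open>0 < d\<close> by (elim continuous_onE[where x = 0 and \<epsilon> = 1]) (auto intro: less_imp_le)
  then have r: "0 < r" "\<And>t. t \<in> {0..d} \<Longrightarrow> t < r \<Longrightarrow> 0 < Re (\<gamma> t)"
    using \<open>\<gamma> 0 = 1\<close> by (force simp: dist_real_def)+
  define \<epsilon> where "\<epsilon> = min d (r/2)"
  have \<epsilon>: "0 < \<epsilon>" "\<epsilon> \<le> d" "\<epsilon> < r"
    using r \<open>0 < d\<close> by (auto simp: \<epsilon>_def)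
  have Re: "0 < Re (\<gamma> t)" if "0 \<le> t" "t \<le> \<epsilon>" for t
    using r that \<epsilon> by auto
  have Im: "Im (\<gamma> t) \<noteq> 0" if "0 < t" "t \<le> \<epsilon>" for t
  proof
    assume "Im (\<gamma> t) = 0"
    then have "\<gamma> t = \<gamma> 0"
      using circle_eqI[of "\<gamma> t" 1] circ[of t] that \<epsilon> Re[of t] \<open>\<gamma> 0 = 1\<close> by auto
    then show False
      using inj_onD[OF inj, of t 0] that \<epsilon> by auto
  qed
  define s where "s = sgn (Im (\<gamma> \<epsilon>))"
  have s: "s = 1 \<or> s = -1"
    using Im[of \<epsilon>] \<epsilon> by (auto simp: s_def sgn_if)
  have "0 < s * Im (\<gamma> t)" if t: "0 < t" "t \<le> \<epsilon>" for t
  proof (rule ccontr)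
    assume neg: "\<not> 0 < s * Im (\<gamma> t)"
    \<comment> \<open>The reference sign is the one at \<epsilon>; a different sign at
      \<open>t\<close> would force a zero in between.\<close>
    have "continuous_on {t..\<epsilon>} (\<lambda>t. s * Im (\<gamma> t))"
      by (intro continuous_intros continuous_on_subset[OF cont]) (use t \<epsilon> in auto)
    moreover have "0 \<le> s * Im (\<gamma> \<epsilon>)"
      by (simp add: s_def sgn_if)
    ultimately obtain x where "t \<le> x" "x \<le> \<epsilon>" "s * Im (\<gamma> x) = 0"
      using IVT'[of "\<lambda>t. s * Im (\<gamma> t)" t 0 \<epsilon>] neg t by auto
    then show False
      using Im[of x] t s by auto
  qed
  then show thesis
    using that s \<epsilon> Re by (metis less_imp_le)
qed

text \<open>Along both arcs \<open>s * Im\<close> climbs from 0 to a positive end value, so both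
  attain the smaller end value \<open>m\<close>. Equal imaginary parts on the right half circle mean
  equal points.\<close>

lemma circle_arcs_same_side_meet:
  fixes \<gamma> \<gamma>' :: "real \<Rightarrow> complex"
  assumes "0 < \<epsilon>" "0 < \<epsilon>'" and s: "s = 1 \<or> s = -1"
    and cont: "continuous_on {0..\<epsilon>} \<gamma>" "continuous_on {0..\<epsilon>'} \<gamma>'"
    and circ: "\<And>t. t \<in> {0..\<epsilon>} \<Longrightarrow> cmod (\<gamma> t) = 1" "\<And>t. t \<in> {0..\<epsilon>'} \<Longrightarrow> cmod (\<gamma>' t) = 1"
    and 1: "\<gamma> 0 = 1" "\<gamma>' 0 = 1"
    and side: "\<And>t. 0 < t \<Longrightarrow> t \<le> \<epsilon> \<Longrightarrow> 0 < Re (\<gamma> t) \<and> 0 < s * Im (\<gamma> t)"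
      "\<And>t. 0 < t \<Longrightarrow> t \<le> \<epsilon>' \<Longrightarrow> 0 < Re (\<gamma>' t) \<and> 0 < s * Im (\<gamma>' t)"
  obtains t t' where "0 < t" "t \<le> \<epsilon>" "0 < t'" "t' \<le> \<epsilon>'" "\<gamma> t = \<gamma>' t'"
proof -
  define m where "m = min (s * Im (\<gamma> \<epsilon>)) (s * Im (\<gamma>' \<epsilon>'))"
  have m: "0 < m" "m \<le> s * Im (\<gamma> \<epsilon>)" "m \<le> s * Im (\<gamma>' \<epsilon>')"
    using side(1)[of \<epsilon>] side(2)[of \<epsilon>'] assms(1,2) by (auto simp: m_def)
  have "continuous_on {0..\<epsilon>} (\<lambda>t. s * Im (\<gamma> t))"
    by (intro continuous_intros cont)
  then obtain t where t: "0 \<le> t" "t \<le> \<epsilon>" "s * Im (\<gamma> t) = m"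
    using IVT'[of "\<lambda>t. s * Im (\<gamma> t)" 0 m \<epsilon>] m assms(1) 1 by auto
  have "continuous_on {0..\<epsilon>'} (\<lambda>t. s * Im (\<gamma>' t))"
    by (intro continuous_intros cont)
  then obtain t' where t': "0 \<le> t'" "t' \<le> \<epsilon>'" "s * Im (\<gamma>' t') = m"
    using IVT'[of "\<lambda>t. s * Im (\<gamma>' t)" 0 m \<epsilon>'] m assms(2) 1 by auto
  have pos: "0 < t" "0 < t'"
    using t t' m 1 by (auto simp: less_le)
  have "\<gamma> t = \<gamma>' t'"
    using t t' pos s circ side by (intro circle_eqI) auto
  then show thesis
    using that pos t t' by blast
qed

text \<open>The arc avoids the branch cut of \<open>Arg\<close>, and the shift
  \<open>(1 - s) * pi\<close> is 0 above the axis and a full turn below. Hence an arc leaving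
  downwards gets the value \<open>2 * pi\<close> at time 0 instead of
  \<open>Arg2pi 1\<close>.\<close>

lemma continuous_on_Arg2pi_arc:
  fixes \<gamma> :: "real \<Rightarrow> complex"
  assumes s: "s = 1 \<or> s = -1" and cont: "continuous_on {0..\<epsilon>} \<gamma>" and "\<gamma> 0 = 1"
    and side: "\<And>t. 0 < t \<Longrightarrow> t \<le> \<epsilon> \<Longrightarrow> 0 < Re (\<gamma> t) \<and> 0 < s * Im (\<gamma> t)"
  shows "continuous_on {0..\<epsilon>} (\<lambda>t. if t = 0 then (1 - s) * pi else Arg2pi (\<gamma> t))"
proof -
  have slit: "\<gamma> t \<notin> \<real>\<^sub>\<le>\<^sub>0" if "t \<in> {0..\<epsilon>}" for t
    using that side[of t] \<open>\<gamma> 0 = 1\<close> by (cases "t = 0") (auto simp: complex_nonpos_Reals_iff)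
  have "continuous_on {0..\<epsilon>} (\<lambda>t. (1 - s) * pi + Arg (\<gamma> t))"
    by (intro continuous_intros cont slit)
  moreover have "(1 - s) * pi + Arg (\<gamma> t) = (if t = 0 then (1 - s) * pi else Arg2pi (\<gamma> t))"
    if "t \<in> {0..\<epsilon>}" for t
    using that s side[of t] \<open>\<gamma> 0 = 1\<close> by (auto simp: Arg2pi_eq_Arg)
  ultimately show ?thesis
    by (rule continuous_on_eq)
qed

subsection \<open>Rays at a vertex\<close>

text \<open>The parameter is the distance from the chosen end along its edge, so tails and heads are
  treated alike.\<close>

fun ray :: "('v, 'e) metric_graph \<Rightarrow> 'e edge_end \<Rightarrow> real \<Rightarrow> ('v, 'e) point" where
  "ray G (Tail_End e) t = chart G e t"
| "ray G (Head_End e) t = chart G e (len G e - t)"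

lemma ray_0: "0 < len G (end_edge k) \<Longrightarrow> ray G k 0 = Vertex (end_vertex G k)"
  by (cases k) (auto simp: chart_def)

lemma continuous_map_ray:
  assumes "end_edge k \<in> edges G"
  shows "continuous_map (top_of_set {0..len G (end_edge k)}) (graph_topology G) (ray G k)"
proof (cases k)
  case (Tail_End e)
  have "ray G (Tail_End e) = chart G e"
    by (simp add: fun_eq_iff)
  then show ?thesis
    using assms continuous_map_chart by (simp add: Tail_End)
next
  case (Head_End e)
  have "continuous_map (top_of_set {0..len G e}) (top_of_set {0..len G e}) (\<lambda>t. len G e - t)"
    by (auto intro!: continuous_intros continuous_map_into_subtopology)
  from continuous_map_compose[OF this continuous_map_chart] have
    "continuous_map (top_of_set {0..len G e}) (graph_topology G) (chart G e \<circ> (\<lambda>t. len G e - t))"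
    using assms by (simp add: Head_End)
  moreover have "ray G (Head_End e) = chart G e \<circ> (\<lambda>t. len G e - t)"
    by (simp add: fun_eq_iff)
  ultimately show ?thesis
    by (simp add: Head_End)
qed

text \<open>Before the midpoint, rays from the two ends of one edge have not met; this also
  separates the two ends of a loop.\<close>

lemma ray_eq_iff:
  assumes "0 < t" "t < len G (end_edge k) / 2" "0 < t'" "t' < len G (end_edge k') / 2"
  shows "ray G k t = ray G k' t' \<longleftrightarrow> k = k' \<and> t = t'"
  using assms by (cases k; cases k') (auto simp: chart_def)

text \<open>Stopping at a third keeps away from the far end, which for a loop is the starting vertex
  again, and stays below the midpoint bound of \<open>ray_eq_iff\<close>.\<close>

lemma inj_on_ray:
  assumes "0 < len G (end_edge k)"
  shows "inj_on (ray G k) {0..len G (end_edge k) / 3}"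
  using assms by (cases k) (auto simp: chart_def inj_on_def split: if_splits)

lemma ray_in_points: "end_edge k \<in> edges G \<Longrightarrow> t \<in> {0..len G (end_edge k)} \<Longrightarrow> ray G k t \<in> points G"
  by (cases k) (auto intro!: chart_in_points)

lemma continuous_on_ray:
  assumes "end_edge k \<in> edges G" "continuous_map (graph_topology G) euclidean F"
  shows "continuous_on {0..len G (end_edge k)} (\<lambda>t. F (ray G k t))"
  using continuous_map_compose[OF continuous_map_ray[OF assms(1)] assms(2)] by (simp add: o_def)

lemma ray_one_side:
  fixes F :: "('v, 'e) point \<Rightarrow> complex"
  assumes k: "end_edge k \<in> edges G" and len: "0 < len G (end_edge k)"
    and cont: "continuous_map (graph_topology G) euclidean F"
    and inj: "inj_on F (points G)" and norm: "\<And>p. p \<in> points G \<Longrightarrow> cmod (F p) = 1"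
    and "F (ray G k 0) = 1"
  obtains s \<epsilon> where "s = 1 \<or> s = -1" "0 < \<epsilon>" "\<epsilon> \<le> len G (end_edge k) / 3"
    "\<And>t. 0 < t \<Longrightarrow> t \<le> \<epsilon> \<Longrightarrow> 0 < Re (F (ray G k t)) \<and> 0 < s * Im (F (ray G k t))"
proof -
  let ?d = "len G (end_edge k) / 3"
  have pts: "ray G k ` {0..?d} \<subseteq> points G"
    using ray_in_points[OF k] len by auto
  then have "inj_on (F \<circ> ray G k) {0..?d}"
    by (intro comp_inj_on inj_on_ray len inj_on_subset[OF inj])
  then have "inj_on (\<lambda>t. F (ray G k t)) {0..?d}"
    by (simp add: o_def)
  moreover have "continuous_on {0..?d} (\<lambda>t. F (ray G k t))"
    using continuous_on_ray[OF k cont] by (rule continuous_on_subset) (use len in auto)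
  moreover have "cmod (F (ray G k t)) = 1" if "t \<in> {0..?d}" for t
    using norm pts that by blast
  moreover have "0 < ?d"
    using len by simp
  ultimately show thesis
    using circle_arc_one_side[where d = ?d and \<gamma> = "\<lambda>t. F (ray G k t)", OF _ _ _ _ \<open>F (ray G k 0) = 1\<close>]
      that by blast
qed

subsection \<open>The cut graph\<close>

lemma cut_at_simps [simp]:
  "vertices (cut_at G v h) = Old ` (vertices G - {v}) \<union> {Cut_Minus, Cut_Plus}"
  "edges (cut_at G v h) = edges G"
  "len (cut_at G v h) = len G"
  "dirichlet_verts (cut_at G v h) = Old ` (dirichlet_verts G - {v}) \<union> {Cut_Minus, Cut_Plus}"
  "end_vertex (cut_at G v h) k = cut_end G v h k"
  by (cases k; simp add: cut_at_def)+

lemma tail_head_cut_at: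
  "tail (graph (cut_at G v h)) e = cut_end G v h (Tail_End e)"
  "head (graph (cut_at G v h)) e = cut_end G v h (Head_End e)"
  by (simp_all add: cut_at_def)

lemma compact_metric_graph_cut_at:
  assumes "compact_metric_graph G"
  shows "compact_metric_graph (cut_at G v h)"
  using assms
  by (auto simp: compact_metric_graph_def fin_digraph_def fin_digraph_axioms_def wf_digraph_def
      tail_head_cut_at cut_end_def)

lemma ends_at_cut_at_Old: "v' \<noteq> v \<Longrightarrow> ends_at (cut_at G v h) (Old v') = ends_at G v'"
  by (auto simp: ends_at_def cut_end_def)

lemma ends_at_cut_at_new:
  "ends_at (cut_at G v h) Cut_Minus \<union> ends_at (cut_at G v h) Cut_Plus = ends_at G v"
  by (auto simp: ends_at_def cut_end_def)

text \<open>At a Dirichlet vertex the edge ends are not coupled, so cutting there leaves the Laplacian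
  unchanged.\<close>

lemma neg_laplacian_cut_at:
  assumes "v \<in> dirichlet_verts G"
  shows "neg_laplacian (cut_at G v h) f g \<longleftrightarrow> neg_laplacian G f g"
proof -
  let ?H = "cut_at G v h"
  have val: "end_value ?H f k = end_value G f k" for k
    by (cases k) simp_all
  have der: "inward_deriv ?H f1 k = inward_deriv G f1 k" for f1 k
    by (cases k) simp_all
  have dir: "(\<forall>w\<in>dirichlet_verts ?H. \<forall>k\<in>ends_at ?H w. end_value G f k = 0) \<longleftrightarrow>
      (\<forall>w\<in>dirichlet_verts G. \<forall>k\<in>ends_at G w. end_value G f k = 0)" (is "?A \<longleftrightarrow> ?B")
  proof -
    \<comment> \<open>The Dirichlet vertices of the cut graph are the old ones other than
      \<open>v\<close> and the two new ones, whose ends together are those of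
      \<open>v\<close>.\<close>
    have "?A \<longleftrightarrow> (\<forall>w\<in>dirichlet_verts G - {v}. \<forall>k\<in>ends_at ?H (Old w). end_value G f k = 0) \<and>
        (\<forall>k\<in>ends_at ?H Cut_Minus \<union> ends_at ?H Cut_Plus. end_value G f k = 0)"
      by auto
    also have "\<dots> \<longleftrightarrow> ?B"
      unfolding ends_at_cut_at_new using assms by (auto simp: ends_at_cut_at_Old)
    finally show ?thesis .
  qed
  have non_dir: "vertices ?H - dirichlet_verts ?H = Old ` (vertices G - dirichlet_verts G)"
    using assms by auto
  have ends: "ends_at ?H (Old w) = ends_at G w" if "w \<in> vertices G - dirichlet_verts G" for w
    using that assms by (intro ends_at_cut_at_Old) auto
  \<comment> \<open>The vertex conditions see a vertex only through its set of ends; abstracting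
    over that set reindexes continuity and Kirchhoff conditions together.\<close>
  have "(\<forall>w\<in>Old ` (vertices G - dirichlet_verts G). Q (ends_at ?H w)) \<longleftrightarrow>
      (\<forall>w\<in>vertices G - dirichlet_verts G. Q (ends_at G w))" for Q
    unfolding ball_simps(9) by (intro ball_cong refl) (simp only: ends)
  from this[of "\<lambda>E. (\<forall>k\<in>E. \<forall>k'\<in>E. end_value G f k = end_value G f k')
      \<and> (\<Sum>k\<in>E. inward_deriv G f1 k) = 0" for f1]
  show ?thesis
    unfolding neg_laplacian_def val der dir non_dir by simp
qed

text \<open>Cutting keeps edges and lengths, so everything about \<open>L2\<close> coincides, and
  only the Laplacian refers to vertices. As \<open>frac_laplacian\<close> becomes the same predicate
  for both graphs, \<open>SOME\<close> picks the same function.\<close>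

lemma torsional_rigidity_cut_at:
  assumes "v \<in> dirichlet_verts G"
  shows "torsional_rigidity \<alpha> (cut_at G v h) = torsional_rigidity \<alpha> G"
proof -
  let ?H = "cut_at G v h"
  have L2: "L2 ?H = L2 G"
    by (simp add: L2_def)
  have int: "graph_integral ?H = graph_integral G"
    by (simp add: graph_integral_def fun_eq_iff)
  have inner: "L2_inner ?H = L2_inner G"
    by (simp add: L2_inner_def fun_eq_iff int)
  have sums: "L2_sums ?H = L2_sums G"
    by (simp add: L2_sums_def fun_eq_iff L2 L2_norm_def inner)
  have "eigenbasis ?H = eigenbasis G"
    by (simp add: eigenbasis_def fun_eq_iff neg_laplacian_cut_at[OF assms] inner L2 sums)
  then have "frac_laplacian \<alpha> ?H = frac_laplacian \<alpha> G"
    by (simp add: frac_laplacian_def fun_eq_iff inner L2 sums)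
  then show ?thesis
    by (simp add: torsional_rigidity_def frac_torsion_def int)
qed

fun glue :: "'v \<Rightarrow> ('v cut_vertex, 'e) point \<Rightarrow> ('v, 'e) point" where
  "glue v (Vertex (Old w)) = Vertex w"
| "glue v (Vertex _) = Vertex v"
| "glue v (Inner e x) = Inner e x"

lemma glue_chart [simp]: "glue v (chart (cut_at G v h) e x) = chart G e x"
  by (auto simp: chart_def tail_head_cut_at cut_end_def)

text \<open>Only \<open>Vertex v\<close> has two preimages in the cut graph, and removing
  \<open>Cut_Plus\<close> leaves \<open>Cut_Minus\<close>. The removed point is the one that will
  receive the angle \<open>2 * pi\<close>.\<close>

lemma glue_points:
  assumes "compact_metric_graph G" "v \<in> vertices G"
  shows "bij_betw (glue v) (points (cut_at G v h) - {Vertex Cut_Plus}) (points G)"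
proof -
  have H: "points (cut_at G v h) = Vertex ` (Old ` (vertices G - {v}) \<union> {Cut_Minus, Cut_Plus})
      \<union> {Inner e x | e x. e \<in> edges G \<and> 0 < x \<and> x < len G e}"
    using points_eq[OF compact_metric_graph_cut_at[OF assms(1)]] by simp
  have "inj_on (glue v) (points (cut_at G v h) - {Vertex Cut_Plus})"
    unfolding H by (auto simp: inj_on_def)
  moreover have "glue v ` (points (cut_at G v h) - {Vertex Cut_Plus}) = points G"
  proof (intro subset_antisym subsetI)
    fix p assume "p \<in> glue v ` (points (cut_at G v h) - {Vertex Cut_Plus})"
    then show "p \<in> points G"
      unfolding H points_eq[OF assms(1)] using assms(2) by auto
  next
    fix p assume p: "p \<in> points G"
    \<comment> \<open>An explicit preimage, with \<open>v\<close> lifted to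
      \<open>Cut_Minus\<close>.\<close>
    define q where "q = (case p of Vertex w \<Rightarrow> Vertex (if w = v then Cut_Minus else Old w)
      | Inner e x \<Rightarrow> Inner e x)"
    have "glue v q = p"
      by (auto simp: q_def split: point.splits)
    moreover have "q \<in> points (cut_at G v h) - {Vertex Cut_Plus}"
      using p unfolding H points_eq[OF assms(1)] by (auto simp: q_def split: if_splits)
    ultimately show "p \<in> glue v ` (points (cut_at G v h) - {Vertex Cut_Plus})"
      by blast
  qed
  ultimately show ?thesis
    by (simp add: bij_betw_def)
qed

subsection \<open>Unrolling the cycle\<close>

text \<open>The last hypothesis fixes the orientation: \<open>h\<close>, the end attached to
  \<open>Cut_Minus\<close>, leaves 1 counterclockwise. The angle then runs from 0 at
  \<open>Cut_Minus\<close> to \<open>2 * pi\<close> at \<open>Cut_Plus\<close>.\<close>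

lemma interval_graph_cut_at_of_circle_map:
  fixes F :: "('v, 'e) point \<Rightarrow> complex"
  assumes G: "compact_metric_graph G" and v: "v \<in> vertices G" and h: "h \<in> ends_at G v"
    and cont: "continuous_map (graph_topology G) euclidean F"
    and inj: "inj_on F (points G)" and onto: "F ` points G = sphere 0 1"
    and Fv: "F (Vertex v) = 1"
    and "0 < \<delta>" and side: "\<And>t. 0 < t \<Longrightarrow> t \<le> \<delta> \<Longrightarrow> 0 < Im (F (ray G h t))"
  shows "interval_graph (cut_at G v h) Cut_Minus Cut_Plus"
proof -
  let ?H = "cut_at G v h"
  let ?l = "\<lambda>k. len G (end_edge k)"
  have fin: "finite (edges G)" and len: "\<And>e. e \<in> edges G \<Longrightarrow> 0 < len G e"
    using G by (auto simp: compact_metric_graph_def fin_digraph_def fin_digraph_axioms_def)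
  have H: "compact_metric_graph ?H"
    using G by (rule compact_metric_graph_cut_at)
  have ends: "end_edge k \<in> edges G" "0 < ?l k" "end_vertex G k = v" if "k \<in> ends_at G v" for k
    using that len by (auto simp: ends_at_def)
  have norm_F: "cmod (F p) = 1" if "p \<in> points G" for p
    using onto that by (metis imageI mem_sphere_0)
  have vp: "Vertex v \<in> points G"
    using v by (simp add: points_def)
  have ray_points: "ray G k t \<in> points G" if "k \<in> ends_at G v" "t \<in> {0..?l k}" for k t
    using ends(1)[OF that(1)] that(2) by (rule ray_in_points)
  have cont_chart: "continuous_on {0..len G e} (\<lambda>x. F (chart G e x))" if "e \<in> edges G" for e
    using continuous_map_compose[OF continuous_map_chart[OF that] cont] by (simp add: o_def)
  have cont_ray: "continuous_on {0..?l k} (\<lambda>t. F (ray G k t))" if "k \<in> ends_at G v" for k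
    using ends(1)[OF that] cont by (rule continuous_on_ray)
  have norm_ray: "cmod (F (ray G k t)) = 1" if "k \<in> ends_at G v" "t \<in> {0..?l k}" for k t
    using norm_F ray_points that by blast
  have ray0: "F (ray G k 0) = 1" if "k \<in> ends_at G v" for k
    using ends[OF that] Fv by (simp add: ray_0)

  \<comment> \<open>For each end, \<open>\<sigma> k\<close> will record the half plane it enters and
    \<open>\<epsilon> k\<close> a distance up to which it stays there.\<close>
  have "\<forall>k\<in>ends_at G v. \<exists>s \<epsilon>. (s = 1 \<or> s = -1) \<and> 0 < \<epsilon> \<and> \<epsilon> \<le> ?l k / 3 \<and>
      (\<forall>t. 0 < t \<longrightarrow> t \<le> \<epsilon> \<longrightarrow> 0 < Re (F (ray G k t)) \<and> 0 < s * Im (F (ray G k t)))"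
  proof
    fix k assume k: "k \<in> ends_at G v"
    show "\<exists>s \<epsilon>. (s = 1 \<or> s = -1) \<and> 0 < \<epsilon> \<and> \<epsilon> \<le> ?l k / 3 \<and>
      (\<forall>t. 0 < t \<longrightarrow> t \<le> \<epsilon> \<longrightarrow> 0 < Re (F (ray G k t)) \<and> 0 < s * Im (F (ray G k t)))"
      using ray_one_side[OF ends(1,2)[OF k] cont inj norm_F ray0[OF k]] by metis
  qed
  then obtain \<sigma> \<epsilon> where \<sigma>: "\<And>k. k \<in> ends_at G v \<Longrightarrow> \<sigma> k = 1 \<or> \<sigma> k = (-1::real)"
    and \<epsilon>: "\<And>k. k \<in> ends_at G v \<Longrightarrow> 0 < \<epsilon> k" "\<And>k. k \<in> ends_at G v \<Longrightarrow> \<epsilon> k \<le> ?l k / 3"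
    and Re_Im: "\<And>k t. k \<in> ends_at G v \<Longrightarrow> 0 < t \<Longrightarrow> t \<le> \<epsilon> k \<Longrightarrow>
      0 < Re (F (ray G k t)) \<and> 0 < \<sigma> k * Im (F (ray G k t))"
    by metis
  have sub: "{0..\<epsilon> k} \<subseteq> {0..?l k}" if "k \<in> ends_at G v" for k
    using \<epsilon>[OF that] ends[OF that] by auto
  have cont_ray_\<epsilon>: "continuous_on {0..\<epsilon> k} (\<lambda>t. F (ray G k t))" if "k \<in> ends_at G v" for k
    using cont_ray[OF that] sub[OF that] by (rule continuous_on_subset)

  have \<sigma>_h: "\<sigma> h = 1"
  proof -
    define t where "t = min \<delta> (\<epsilon> h)"
    have "0 < t" "t \<le> \<delta>" "t \<le> \<epsilon> h"
      using \<open>0 < \<delta>\<close> \<epsilon>[OF h] by (auto simp: t_def)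
    then have "0 < Im (F (ray G h t))" "0 < \<sigma> h * Im (F (ray G h t))"
      using side Re_Im[OF h] by auto
    then show ?thesis
      using \<sigma>[OF h] by auto
  qed
  \<comment> \<open>A second end in the upper half plane would meet \<open>h\<close> on the circle.
    Injectivity of \<open>F\<close> turns this into a common point of two distinct rays before their
    midpoints, against \<open>ray_eq_iff\<close>.\<close>
  have \<sigma>_other: "\<sigma> k = -1" if k: "k \<in> ends_at G v" "k \<noteq> h" for k
  proof (rule ccontr)
    assume "\<sigma> k \<noteq> -1"
    then have "\<sigma> k = 1"
      using \<sigma> k by blast
    have nh: "cmod (F (ray G h t)) = 1" if "t \<in> {0..\<epsilon> h}" for t
      using norm_ray[OF h] sub[OF h] that by blast
    have nk: "cmod (F (ray G k t)) = 1" if "t \<in> {0..\<epsilon> k}" for t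
      using norm_ray[OF k(1)] sub[OF k(1)] that by blast
    have rh: "0 < Re (F (ray G h t)) \<and> 0 < 1 * Im (F (ray G h t))" if "0 < t" "t \<le> \<epsilon> h" for t
      using Re_Im[OF h that] \<sigma>_h by simp
    have rk: "0 < Re (F (ray G k t)) \<and> 0 < 1 * Im (F (ray G k t))" if "0 < t" "t \<le> \<epsilon> k" for t
      using Re_Im[OF k(1) that] \<open>\<sigma> k = 1\<close> by simp
    obtain t t' where t: "0 < t" "t \<le> \<epsilon> h" "0 < t'" "t' \<le> \<epsilon> k" "F (ray G h t) = F (ray G k t')"
      by (rule circle_arcs_same_side_meet[OF \<epsilon>(1)[OF h] \<epsilon>(1)[OF k(1)] disjI1[OF refl]
            cont_ray_\<epsilon>[OF h] cont_ray_\<epsilon>[OF k(1)] nh nk ray0[OF h] ray0[OF k(1)] rh rk])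
    have "ray G h t = ray G k t'"
      using t sub[OF h] sub[OF k(1)] by (intro inj_onD[OF inj t(5)] ray_points h k) auto
    then show False
      using t \<epsilon>(2)[OF h] \<epsilon>(2)[OF k(1)] ends(2)[OF h] ends(2)[OF k(1)] k(2)
        ray_eq_iff[of t G h t' k] by auto
  qed

  \<comment> \<open>Thus at most one other end exists; the angle tends to \<open>0\<close> along \<open>h\<close> and to \<open>2\<pi>\<close> along it.\<close>
  define U where "U p = (if p = Vertex Cut_Plus then 2 * pi else Arg2pi (F (glue v p)))"
    for p :: "('v cut_vertex, 'e) point"
  have cont_U_ray: "continuous_on {0..\<epsilon> k} (\<lambda>t. U (ray ?H k t))" if k: "k \<in> ends_at G v" for k
  proof (rule continuous_on_eq)
    show "continuous_on {0..\<epsilon> k} (\<lambda>t. if t = 0 then (1 - \<sigma> k) * pi else Arg2pi (F (ray G k t)))"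
      using \<sigma>[OF k] cont_ray_\<epsilon>[OF k] ray0[OF k] Re_Im[OF k] by (rule continuous_on_Arg2pi_arc)
    fix t assume t: "t \<in> {0..\<epsilon> k}"
    have glue: "glue v (ray ?H k t) = ray G k t"
      by (cases k) simp_all
    \<comment> \<open>At \<open>t = 0\<close> the sign matches the cut: \<open>h\<close> has sign 1
      and ends at \<open>Cut_Minus\<close> with angle 0, any other end has sign -1 and ends at
      \<open>Cut_Plus\<close> with angle \<open>2 * pi\<close>.\<close>
    show "(if t = 0 then (1 - \<sigma> k) * pi else Arg2pi (F (ray G k t))) = U (ray ?H k t)"
    proof (cases "t = 0")
      case True
      have "Arg2pi 1 = 0"
        using Arg2pi_of_real[of 1] by simp
      then show ?thesis
        using True ends[OF k] \<sigma>_h \<sigma>_other[OF k] Fv ray_0[of ?H k]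
        by (auto simp: U_def cut_end_def)
    next
      case False
      then have "F (ray G k t) \<noteq> 1"
        using Re_Im[OF k, of t] t by auto
      then have "ray ?H k t \<noteq> Vertex Cut_Plus"
        using glue Fv by auto
      then show ?thesis
        using False glue by (simp add: U_def)
    qed
  qed

  have cont_U: "continuous_on {0..len G e} (\<lambda>x. U (chart ?H e x))" if e: "e \<in> edges G" for e
    unfolding continuous_on_def
  proof
    fix x assume x: "x \<in> {0..len G e}"
    let ?I = "at x within {0..len G e}"
    show "((\<lambda>x. U (chart ?H e x)) \<longlongrightarrow> U (chart ?H e x)) ?I"
    proof (cases "chart G e x = Vertex v")
      case False
      have U_eq: "U (chart ?H e y) = Arg2pi (F (chart G e y))" if "F (chart G e y) \<noteq> 1" for y
        
      proof -
        have "chart ?H e y \<noteq> Vertex Cut_Plus"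
          using that Fv by (metis glue.simps(3) glue_chart)
        then show ?thesis
          by (simp add: U_def)
      qed
      have lim: "((\<lambda>y. F (chart G e y)) \<longlongrightarrow> F (chart G e x)) ?I"
        using cont_chart[OF e] x by (simp add: continuous_on_def)
      have ne: "F (chart G e x) \<noteq> 1"
        using False Fv inj_onD[OF inj, of "chart G e x" "Vertex v"] chart_in_points[OF e x] vp by auto
      \<comment> \<open>The only nonnegative real on the unit circle is 1, so away from
        \<open>v\<close> the map \<open>Arg2pi\<close> is continuous at the image.\<close>
      have "F (chart G e x) \<notin> \<real>\<^sub>\<ge>\<^sub>0"
      proof
        assume "F (chart G e x) \<in> \<real>\<^sub>\<ge>\<^sub>0"
        then obtain r where "0 \<le> r" "F (chart G e x) = of_real r"
          by (auto simp: nonneg_Reals_def)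
        then show False
          using ne norm_F[OF chart_in_points[OF e x]] by simp
      qed
      then have "((\<lambda>y. Arg2pi (F (chart G e y))) \<longlongrightarrow> Arg2pi (F (chart G e x))) ?I"
        using lim continuous_at_Arg2pi isCont_tendsto_compose by blast
      moreover have "\<forall>\<^sub>F y in ?I. Arg2pi (F (chart G e y)) = U (chart ?H e y)"
        using tendsto_imp_eventually_ne[OF lim ne] by eventually_elim (simp add: U_eq)
      ultimately show ?thesis
        unfolding U_eq[OF ne] by (rule Lim_transform_eventually)
    next
      case True
      then consider "x = 0" "tail (graph G) e = v" | "x = len G e" "head (graph G) e = v"
        by (auto simp: chart_def split: if_splits)
      then show ?thesis
      proof cases
        case 1
        define k where "k = Tail_End e"
        have k: "k \<in> ends_at G v"
          using 1 e by (simp add: k_def ends_at_def)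
        have "continuous_on {0..\<epsilon> k} (\<lambda>y. U (chart ?H e y))"
          using cont_U_ray[OF k] by (simp add: k_def)
        moreover have "x \<in> {0..\<epsilon> k}"
          using 1 \<epsilon>(1)[OF k] by simp
        \<comment> \<open>At an end point the limit is one-sided and local, so the short initial
          piece may replace the whole edge.\<close>
        moreover have "at x within {0..\<epsilon> k} = ?I"
          using 1 \<epsilon>(1)[OF k] len[OF e] by (simp add: at_within_Icc_at_right)
        ultimately show ?thesis
          unfolding continuous_on_def by metis
      next
        case 2
        define k where "k = Head_End e"
        have k: "k \<in> ends_at G v"
          using 2 e by (simp add: k_def ends_at_def)
        \<comment> \<open>From the head the ray runs backwards; reversing it turns distance from the
          vertex into the edge coordinate.\<close>
        have "continuous_on {len G e - \<epsilon> k..len G e} (\<lambda>y. U (ray ?H k (len G e - y)))"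
          by (rule continuous_on_compose2[OF cont_U_ray[OF k]]) (auto intro!: continuous_intros)
        then have "continuous_on {len G e - \<epsilon> k..len G e} (\<lambda>y. U (chart ?H e y))"
          by (simp add: k_def)
        moreover have "at x within {len G e - \<epsilon> k..len G e} = ?I"
          using 2 \<epsilon>(1)[OF k] len[OF e] by (simp add: at_within_Icc_at_left)
        moreover have "x \<in> {len G e - \<epsilon> k..len G e}"
          using 2 \<epsilon>(1)[OF k] by simp
        ultimately show ?thesis
          unfolding continuous_on_def by metis
      qed
    qed
  qed

  have bij: "bij_betw (glue v) (points ?H - {Vertex Cut_Plus}) (points G)"
    using G v by (rule glue_points)
  have arg: "bij_betw Arg2pi (sphere 0 1) {0..<2 * pi}"
    by (rule bij_betw_byWitness[where f' = cis])
      (auto simp: Arg2pi_ge_0 Arg2pi_lt_2pi cis_conv_exp complex_norm_eq_1_exp Arg2pi_exp)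
  have "bij_betw F (points G) (sphere 0 1)"
    using inj onto by (simp add: bij_betw_def)
  \<comment> \<open>Without \<open>Cut_Plus\<close> the angle fills the half-open interval; adding
    that point supplies the missing value \<open>2 * pi\<close>.\<close>
  then have "bij_betw (Arg2pi \<circ> (F \<circ> glue v)) (points ?H - {Vertex Cut_Plus}) {0..<2 * pi}"
    by (rule bij_betw_trans[OF bij_betw_trans[OF bij] arg])
  moreover have "bij_betw U {Vertex Cut_Plus} {2 * pi}"
    by (simp add: U_def)
  moreover have "bij_betw (Arg2pi \<circ> (F \<circ> glue v)) (points ?H - {Vertex Cut_Plus}) {0..<2 * pi}
      \<longleftrightarrow> bij_betw U (points ?H - {Vertex Cut_Plus}) {0..<2 * pi}"
    by (intro bij_betw_cong) (simp add: U_def)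
  ultimately have "bij_betw U ((points ?H - {Vertex Cut_Plus}) \<union> {Vertex Cut_Plus})
      ({0..<2 * pi} \<union> {2 * pi})"
    by (intro bij_betw_combine) auto
  moreover have "(points ?H - {Vertex Cut_Plus}) \<union> {Vertex Cut_Plus} = points ?H"
    by (auto simp: points_def)
  moreover have "{0..<2 * pi} \<union> {2 * pi} = {0..2 * pi}"
    using pi_gt_zero by (auto simp: less_le)
  ultimately have bij_U: "bij_betw U (points ?H) {0..2 * pi}"
    by simp

  define L where "L = total_length ?H"
  have "0 < L"
    using fin len ends(1)[OF h] by (auto simp: L_def total_length_def intro!: sum_pos)
  \<comment> \<open>The angle is rescaled so that a full turn becomes the total length.\<close>
  define K where "K p = L / (2 * pi) * U p" for p
  have "bij_betw (\<lambda>x. L / (2 * pi) * x) {0..2 * pi} {0..L}"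
    by (rule bij_betw_byWitness[where f' = "\<lambda>x. x * (2 * pi) / L"])
      (use \<open>0 < L\<close> in \<open>auto simp: field_simps\<close>)
  then have bij_K: "bij_betw K (points ?H) {0..L}"
    using bij_betw_trans[OF bij_U, of "\<lambda>x. L / (2 * pi) * x" "{0..L}"]
    by (simp add: K_def[abs_def] o_def)
  have "homeomorphic_map (graph_topology ?H) (top_of_set {0..L}) K"
  proof (rule continuous_imp_homeomorphic_map)
    show "continuous_map (graph_topology ?H) (top_of_set {0..L}) K"
    proof (rule continuous_map_from_graph)
      show "K ` points ?H \<subseteq> topspace (top_of_set {0..L})"
        using bij_K by (simp add: bij_betw_def)
      fix e assume e: "e \<in> edges ?H"
      have "continuous_on {0..len ?H e} (\<lambda>x. K (chart ?H e x))"
        unfolding K_def using cont_U e by (intro continuous_intros) simp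
      moreover have "K (chart ?H e x) \<in> {0..L}" if "x \<in> {0..len ?H e}" for x
        using bij_betwE[OF bij_K] chart_in_points[OF e that] by blast
      ultimately show "continuous_map (top_of_set {0..len ?H e}) (top_of_set {0..L})
          (\<lambda>x. K (chart ?H e x))"
        by (intro continuous_map_into_subtopology) auto
    qed
    show "compact_space (graph_topology ?H)"
      using H by (rule compact_space_graph_topology)
    show "Hausdorff_space (top_of_set {0..L})"
      by (simp add: Hausdorff_space_subtopology)
  qed (use bij_K in \<open>auto simp: bij_betw_def\<close>)
  moreover have "K (Vertex Cut_Minus) = 0"
    using Fv Arg2pi_of_real[of 1] by (simp add: K_def U_def)
  moreover have "K (Vertex Cut_Plus) = L"
    by (simp add: K_def U_def)
  ultimately show ?thesis
    using H by (auto simp: interval_graph_def L_def)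
qed

text \<open>Any homeomorphism onto the circle can be normalised: a rotation moves the image of
  \<open>v\<close> to 1, and complex conjugation, which fixes 1, makes \<open>h\<close> leave into
  the upper half plane.\<close>

lemma interval_graph_cut_at:
  assumes C: "cycle_graph C" and v: "v \<in> vertices C" and h: "h \<in> ends_at C v"
  shows "interval_graph (cut_at C v h) Cut_Minus Cut_Plus"
proof -
  have G: "compact_metric_graph C"
    using C by (simp add: cycle_graph_def)
  have e: "end_edge h \<in> edges C" "0 < len C (end_edge h)" "end_vertex C h = v"
    using G h by (auto simp: ends_at_def compact_metric_graph_def)
  have vp: "Vertex v \<in> points C"
    using v by (simp add: points_def)
  obtain f where f: "homeomorphic_map (graph_topology C) (top_of_set (sphere (0::complex) 1)) f"
    using C by (auto simp: cycle_graph_def homeomorphic_space)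
  have f_cont: "continuous_map (graph_topology C) euclidean f"
    using homeomorphic_imp_continuous_map[OF f] by (rule continuous_map_into_fulltopology)
  have f_inj: "inj_on f (points C)"
    using homeomorphic_imp_injective_map[OF f] by simp
  have f_onto: "f ` points C = sphere 0 1"
    using homeomorphic_imp_surjective_map[OF f] by simp
  define c where "c = f (Vertex v)"
  have c: "cmod c = 1"
    using f_onto vp unfolding c_def by (metis imageI mem_sphere_0)
  \<comment> \<open>As \<open>c\<close> has modulus 1, multiplication by its conjugate is the
    rotation taking \<open>c\<close> to 1.\<close>
  define F where "F p = cnj c * f p" for p
  have cc: "cnj c * c = 1" "c * cnj c = 1"
    using complex_norm_square[of c] c by (simp_all add: mult.commute)
  have rot: "(\<lambda>z. cnj c * z) ` sphere 0 1 = sphere 0 1"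
  proof (intro subset_antisym subsetI)
    fix z assume "z \<in> sphere (0::complex) 1"
    then have "c * z \<in> sphere 0 1" "z = cnj c * (c * z)"
      using c cc by (simp_all add: norm_mult flip: mult.assoc)
    then show "z \<in> (\<lambda>z. cnj c * z) ` sphere 0 1"
      by blast
  qed (use c in \<open>auto simp: norm_mult\<close>)
  have F_cont: "continuous_map (graph_topology C) euclidean F"
  proof -
    have "continuous_map euclidean euclidean (\<lambda>z. cnj c * z)"
      by (simp add: continuous_on_mult_left)
    from continuous_map_compose[OF f_cont this] show ?thesis
      by (simp add: o_def F_def[abs_def])
  qed
  have F_inj: "inj_on F (points C)"
    using f_inj c by (auto simp: F_def inj_on_def)
  have F_onto: "F ` points C = sphere 0 1"
  proof -
    have "F ` points C = (\<lambda>z. cnj c * z) ` f ` points C"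
      by (simp add: F_def image_image)
    then show ?thesis
      by (simp only: f_onto rot)
  qed
  have Fv: "F (Vertex v) = 1"
    using cc by (simp add: F_def c_def)
  have norm_F: "cmod (F p) = 1" if "p \<in> points C" for p
    using F_onto that by (metis imageI mem_sphere_0)
  have "F (ray C h 0) = 1"
    using e Fv by (simp add: ray_0)
  from ray_one_side[OF e(1,2) F_cont F_inj norm_F this]
  obtain s \<epsilon> where s: "s = 1 \<or> s = -1" and "0 < \<epsilon>"
    and side: "\<And>t. 0 < t \<Longrightarrow> t \<le> \<epsilon> \<Longrightarrow> 0 < Re (F (ray C h t)) \<and> 0 < s * Im (F (ray C h t))"
    by metis
  from s show ?thesis
  proof
    assume "s = 1"
    then show ?thesis
      using side by (intro interval_graph_cut_at_of_circle_map[OF G v h F_cont F_inj F_onto Fv \<open>0 < \<epsilon>\<close>]) auto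
  next
    assume "s = -1"
    \<comment> \<open>Here \<open>h\<close> leaves downwards, so the circle is reflected in the real
      axis.\<close>
    let ?F = "\<lambda>p. cnj (F p)"
    have 1: "continuous_map (graph_topology C) euclidean ?F"
    proof -
      have "continuous_map euclidean euclidean cnj"
        by (simp add: continuous_on_cnj)
      from continuous_map_compose[OF F_cont this] show ?thesis
        by (simp add: o_def)
    qed
    have 2: "inj_on ?F (points C)"
      using F_inj by (simp add: inj_on_def)
    have "cnj ` sphere 0 1 = sphere 0 1"
    proof (intro subset_antisym subsetI)
      fix z assume "z \<in> sphere (0::complex) 1"
      then have "cnj z \<in> sphere 0 1" "z = cnj (cnj z)"
        by simp_all
      then show "z \<in> cnj ` sphere 0 1"
        by blast
    qed auto
    moreover have "?F ` points C = cnj ` F ` points C"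
      by (simp only: image_image)
    ultimately have 3: "?F ` points C = sphere 0 1"
      by (simp only: F_onto)
    have 4: "?F (Vertex v) = 1"
      using Fv by simp
    show ?thesis
      using side \<open>s = -1\<close>
      by (intro interval_graph_cut_at_of_circle_map[OF G v h 1 2 3 4 \<open>0 < \<epsilon>\<close>]) auto
  qed
qed

text \<open>The end \<open>h\<close> decides which side of the cut is called
  \<open>Cut_Minus\<close>; since it is arbitrary, every such labelling is covered.\<close>

theorem theorem6p3:
  fixes \<alpha> L :: real
    and C :: "('v, 'e) metric_graph"
    and v0 :: 'v and h :: "'e edge_end"
  assumes "0 < \<alpha>" and "\<alpha> < 1"
    and "cycle_graph C" and "total_length C = L"
    and "v0 \<in> dirichlet_verts C"
    and "h \<in> ends_at C v0"
  shows "interval_graph (cut_at C v0 h) Cut_Minus Cut_Plus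
       \<and> total_length (cut_at C v0 h) = L
       \<and> {Cut_Minus, Cut_Plus} \<subseteq> dirichlet_verts (cut_at C v0 h)
       \<and> torsional_rigidity \<alpha> C = torsional_rigidity \<alpha> (cut_at C v0 h)"
proof (intro conjI)
  have "v0 \<in> vertices C"
    using assms(3,5) by (auto simp: cycle_graph_def compact_metric_graph_def)
  then show "interval_graph (cut_at C v0 h) Cut_Minus Cut_Plus"
    using assms(3,6) by (intro interval_graph_cut_at)
  show "total_length (cut_at C v0 h) = L"
    using assms(4) by (simp add: total_length_def)
  show "torsional_rigidity \<alpha> C = torsional_rigidity \<alpha> (cut_at C v0 h)"
    using assms(5) by (simp add: torsional_rigidity_cut_at)
qed simp

end
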